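(* Let $\mathcal{P}$ be the Petersen graph. Then $\mathrm{cdim}(\mathcal{P})=4=\mathrm{cdim}_{\mathcal{P}}(v)$ for any $v\in V(\mathcal{P})$.
   Context: A set $S\subseteq V(G)$ is a resolving set of a connected graph $G$ if for every pair of distinct vertices $x,y$ of $G$ there is $z\in S$ with $d(x,z)\ne d(y,z)$ ($d$ is the shortest-path distance); it is a connected resolving set if moreover the induced subgraph $G[S]$ is connected. $\mathrm{cdim}(G)$ is the minimum cardinality of a connected resolving set of $G$, and $\mathrm{cdim}_G(v)$ is the minimum cardinality of a connected resolving set containing $v$. *)

theory Defs
  imports "Graph_Theory.Graph_Theory"
begin

text \<open>
  Graphs are symmetric digraphs, as in the locale \<^locale>\<open>graph\<close>. The notions below are meant for
  (finite) connected graphs.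
\<close>

text \<open>
  The infimum of the lengths of all walks between the two vertices; the value is an extended real,
  equal to infinity exactly when there is no such walk.
\<close>

definition gdist :: "('a, 'b) pre_digraph \<Rightarrow> 'a \<Rightarrow> 'a \<Rightarrow> ereal" where
  "gdist G x y = wf_digraph.\<mu> G (\<lambda>_. 1) x y"

definition resolving_set :: "('a, 'b) pre_digraph \<Rightarrow> 'a set \<Rightarrow> bool" where
  "resolving_set G S \<longleftrightarrow> S \<subseteq> verts G \<and>
     (\<forall>x \<in> verts G. \<forall>y \<in> verts G. x \<noteq> y \<longrightarrow> (\<exists>z \<in> S. gdist G x z \<noteq> gdist G y z))"

text \<open>
  The name is qualified because \<^const>\<open>Topological_Spaces.connected\<close> is also in scope.
\<close>

definition connected_resolving_set :: "('a, 'b) pre_digraph \<Rightarrow> 'a set \<Rightarrow> bool" where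
  "connected_resolving_set G S \<longleftrightarrow>
     resolving_set G S \<and> Digraph_Component.connected (G \<restriction> S)"

text \<open>
  On a finite connected graph with at least one vertex the vertex set itself is a connected
  resolving set, so both minima are attained
  (the second one for every vertex).
\<close>

definition cdim :: "('a, 'b) pre_digraph \<Rightarrow> nat" where
  "cdim G = (LEAST k. \<exists>S. connected_resolving_set G S \<and> card S = k)"

definition cdim_at :: "('a, 'b) pre_digraph \<Rightarrow> 'a \<Rightarrow> nat" where
  "cdim_at G v = (LEAST k. \<exists>S. connected_resolving_set G S \<and> v \<in> S \<and> card S = k)"

text \<open>
  The Petersen graph as the Kneser graph on the 2-element subsets of a 5-element set, two of them
  being adjacent when they are disjoint.
\<close>

definition petersen :: "nat set pair_pre_digraph" where
  "petersen =
     \<lparr> pverts = {A. A \<subseteq> {0..<5} \<and> card A = 2},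
       parcs = {(A, B). A \<subseteq> {0..<5} \<and> card A = 2 \<and> B \<subseteq> {0..<5} \<and> card B = 2 \<and> A \<inter> B = {}} \<rparr>"

lemma pair_graph_petersen: "pair_graph petersen"
proof
  have fin: "finite (pverts petersen)"
    by (rule finite_subset[of _ "Pow {0..<5}"]) (auto simp: petersen_def)
  then show "finite (pverts petersen)" .
  show "finite (parcs petersen)"
    by (rule finite_subset[OF _ finite_cartesian_product[OF fin fin]]) (auto simp: petersen_def)
  show "fst e \<in> pverts petersen" "snd e \<in> pverts petersen" if "e \<in> parcs petersen" for e
    using that by (auto simp: petersen_def)
  show "fst e \<noteq> snd e" if "e \<in> parcs petersen" for e
    using that by (auto simp: petersen_def)
  show "symmetric (with_proj petersen)"
    by (auto simp: symmetric_def petersen_def intro!: symI)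
qed

lemma connected_petersen: "Digraph_Component.connected (with_proj petersen)"
proof -
  interpret pair_graph petersen by (rule pair_graph_petersen)
  have adj: "A \<rightarrow>\<^sup>*\<^bsub>with_proj petersen\<^esub> B" if "(A, B) \<in> parcs petersen" for A B
    using that by (intro reachable_adjI) simp
  have "A \<rightarrow>\<^sup>*\<^bsub>with_proj petersen\<^esub> B"
    if A: "A \<in> pverts petersen" and B: "B \<in> pverts petersen" for A B
  proof (cases "A \<inter> B = {} \<or> A = B")
    case True
    then show ?thesis
    proof
      assume "A \<inter> B = {}"
      then show ?thesis using A B by (intro adj) (auto simp: petersen_def)
    next
      assume "A = B"
      then show ?thesis using A by (simp add: reachable_refl)
    qed
  next
    case False
    have fin: "finite A" "finite B"
      using A B by (auto simp: petersen_def intro: finite_subset)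
    have "card (A \<inter> B) \<noteq> 0"
      using False fin by simp
    moreover have "card (A \<union> B) + card (A \<inter> B) = 4"
      using card_Un_Int[OF fin] A B by (simp add: petersen_def)
    ultimately have "card (A \<union> B) \<le> 3" by simp
    then have "card ({0..<5} - (A \<union> B)) \<ge> 2"
      using A B fin by (subst card_Diff_subset) (auto simp: petersen_def)
    then obtain C where C: "C \<subseteq> {0..<5} - (A \<union> B)" "card C = 2"
      by (meson obtain_subset_with_card_n)
    have "(A, C) \<in> parcs petersen" "(C, B) \<in> parcs petersen"
      using A B C by (auto simp: petersen_def)
    then show ?thesis by (blast intro: adj reachable_trans)
  qed
  moreover have "{0, 1} \<in> pverts petersen"
    by (auto simp: petersen_def)
  ultimately show ?thesis
    by (intro connectedI) (auto intro: reachable_mk_symmetricI)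
qed

end

theory Submission
  imports Defs
begin

text \<open>
  The vertices are the two-element subsets of a five-element set, so the Petersen graph has diameter
  two and the distance between distinct vertices is one or two, according to whether they are
  disjoint or meet (\<open>gdist_petersen\<close>). Hence a vertex outside a set \<open>S\<close> is resolved by \<open>S\<close> only
  through the set of its neighbours in \<open>S\<close>.

  Three vertices are too few. A connected set of at most three vertices is a star, and as the
  Petersen graph is cubic it lies on a path \<open>a\<close>, \<open>b\<close>, \<open>c\<close> of three distinct vertices. The end
  \<open>a\<close> has two neighbours other than \<open>b\<close>. They are not adjacent to \<open>b\<close> or \<open>c\<close>, because the girth
  is five, so nothing on the path distinguishes them (\<open>not_resolving_path3\<close>).

  Four vertices suffice. On a path of four vertices whose ends are not adjacent, the ends have
  exactly one common neighbour. The six vertices off the path are this common neighbour,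
  one private neighbour of each of the four path vertices and one vertex without neighbours on the
  path; so they see six different sets of path vertices, while a path vertex is
  recognised by its distance zero to itself (\<open>resolving_path4\<close>). Every vertex is the
  end of such a path.
\<close>

section \<open>Short distances\<close>

context wf_digraph
begin

lemma awalk_unit_cost: "awalk_cost (\<lambda>_. 1) p = real (length p)"
  by (induction p) auto

lemma gdist_eqI:
  assumes "awalk u p v" "\<And>q. awalk u q v \<Longrightarrow> length p \<le> length q"
  shows "gdist G u v = ereal (real (length p))"
  unfolding gdist_def \<mu>_def
  by (rule INF_eqI) (use assms in \<open>auto simp: awalk_unit_cost\<close>)

lemma gdist_self: "u \<in> verts G \<Longrightarrow> gdist G u u = 0"
  using gdist_eqI[of u "[]" u] by (simp add: awalk_Nil_iff zero_ereal_def)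

lemma gdist_adjacent:
  assumes "u \<rightarrow>\<^bsub>G\<^esub> v" "u \<noteq> v"
  shows "gdist G u v = 1"
proof -
  obtain e where e: "e \<in> arcs G" "tail G e = u" "head G e = v"
    using assms by (auto simp: arcs_ends_conv)
  have "gdist G u v = ereal (real (length [e]))"
  proof (rule gdist_eqI)
    show "awalk u [e] v" using e by (auto simp: awalk_simps)
    show "length [e] \<le> length q" if "awalk u q v" for q
      using that assms by (cases q) (auto simp: awalk_simps)
  qed
  then show ?thesis by (simp add: one_ereal_def)
qed

lemma gdist_common_neighbour:
  assumes "u \<rightarrow>\<^bsub>G\<^esub> w" "w \<rightarrow>\<^bsub>G\<^esub> v" "u \<noteq> v" "\<not> u \<rightarrow>\<^bsub>G\<^esub> v"
  shows "gdist G u v = 2"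
proof -
  obtain e where e: "e \<in> arcs G" "tail G e = u" "head G e = w"
    using assms by (auto simp: arcs_ends_conv)
  obtain f where f: "f \<in> arcs G" "tail G f = w" "head G f = v"
    using assms by (auto simp: arcs_ends_conv)
  have "gdist G u v = ereal (real (length [e, f]))"
  proof (rule gdist_eqI)
    show "awalk u [e, f] v" using e f by (auto simp: awalk_simps)
    show "length [e, f] \<le> length q" if q: "awalk u q v" for q
    proof (cases q)
      case Nil
      then show ?thesis using q assms by (auto simp: awalk_simps)
    next
      case (Cons g q')
      then have "q' \<noteq> []"
        using q assms by (auto simp: awalk_simps arcs_ends_conv)
      then show ?thesis using Cons by (cases q') auto
    qed
  qed
  then show ?thesis by simp
qed

end

section \<open>Connected induced subgraphs\<close>

lemma adj_induce_subgraph: "u \<rightarrow>\<^bsub>G \<restriction> S\<^esub> v \<longleftrightarrow> u \<in> S \<and> v \<in> S \<and> u \<rightarrow>\<^bsub>G\<^esub> v"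
  by (auto simp: arcs_ends_conv)

lemma connected_induce_singleton: "Digraph_Component.connected (G \<restriction> {b})"
  by (auto simp: connected_conv)

lemma connected_induce_insert:
  assumes S: "Digraph_Component.connected (G \<restriction> S)" and "b \<in> S" "a \<rightarrow>\<^bsub>G\<^esub> b"
  shows "Digraph_Component.connected (G \<restriction> (insert a S))"
proof -
  let ?T = "insert a S"
  let ?r = "\<lambda>U. rtrancl_on U ((arcs_ends (G \<restriction> U))\<^sup>s)"
  have "arcs_ends (G \<restriction> S) \<subseteq> arcs_ends (G \<restriction> ?T)"
    by (auto simp: arcs_ends_conv)
  then have "(arcs_ends (G \<restriction> S))\<^sup>s \<subseteq> (arcs_ends (G \<restriction> ?T))\<^sup>s"
    by (auto simp: symcl_def)
  then have mono: "?r S \<subseteq> ?r ?T"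
    by (metis rtrancl_on_mono subset_insertI subrelI)
  have inner: "(u, v) \<in> ?r ?T" if "u \<in> S" "v \<in> S" for u v
    using S that mono by (auto simp: connected_conv)
  have "(a, b) \<in> (arcs_ends (G \<restriction> ?T))\<^sup>s" "(b, a) \<in> (arcs_ends (G \<restriction> ?T))\<^sup>s"
    using assms adj_induce_subgraph[of a b G ?T] by (auto simp: symcl_def)
  then have ab: "(a, b) \<in> ?r ?T" "(b, a) \<in> ?r ?T"
    using \<open>b \<in> S\<close> by (auto intro: rtrancl_on_into_rtrancl_on)
  have "(u, v) \<in> ?r ?T" if "u \<in> ?T" "v \<in> ?T" for u v
  proof -
    have "(u, b) \<in> ?r ?T" "(b, v) \<in> ?r ?T"
      using that inner ab \<open>b \<in> S\<close> by auto
    then show ?thesis by (rule rtrancl_on_trans)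
  qed
  then show ?thesis by (simp add: connected_conv)
qed

lemma connected_induce_has_neighbour:
  assumes "symmetric G" "Digraph_Component.connected (G \<restriction> S)" "u \<in> S" "v \<in> S" "u \<noteq> v"
  shows "\<exists>w \<in> S. u \<rightarrow>\<^bsub>G\<^esub> w"
proof -
  have "(u, v) \<in> rtrancl_on S ((arcs_ends (G \<restriction> S))\<^sup>s)"
    using assms by (auto simp: connected_conv)
  then obtain w where "(u, w) \<in> (arcs_ends (G \<restriction> S))\<^sup>s"
    using \<open>u \<noteq> v\<close> by (cases rule: converse_rtrancl_on_cases) auto
  then have "u \<rightarrow>\<^bsub>G \<restriction> S\<^esub> w \<or> w \<rightarrow>\<^bsub>G \<restriction> S\<^esub> u"
    by (auto simp: symcl_def)
  then show ?thesis
    using arcs_ends_symmetric[OF \<open>symmetric G\<close>] unfolding adj_induce_subgraph by blast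
qed

text \<open>
  No vertex of a connected set of at least two vertices is isolated; among three vertices this
  leaves no graph other than the path and the triangle, and both have a centre.
\<close>

lemma (in graph) connected_induce_card_le_3_star:
  assumes S: "Digraph_Component.connected (G \<restriction> S)"
    and "finite S" "card S \<le> 3"
  shows "\<exists>b \<in> S. \<forall>x \<in> S - {b}. b \<rightarrow>\<^bsub>G\<^esub> x"
proof -
  have nb: "\<exists>w \<in> S - {u}. u \<rightarrow>\<^bsub>G\<^esub> w" if "u \<in> S" "v \<in> S" "u \<noteq> v" for u v
    using connected_induce_has_neighbour[OF sym_arcs S that] adj_not_same by blast
  have sym: "v \<rightarrow>\<^bsub>G\<^esub> u \<longleftrightarrow> u \<rightarrow>\<^bsub>G\<^esub> v" for u v
    using arcs_ends_symmetric[OF sym_arcs] by blast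
  have "card S \<noteq> 0"
    using S \<open>finite S\<close> by (auto simp: connected_conv)
  then consider "card S = 1" | "card S = 2" | "card S = 3"
    using \<open>card S \<le> 3\<close> by linarith
  then show ?thesis
  proof cases
    case 1
    then show ?thesis by (auto simp: card_1_singleton_iff)
  next
    case 2
    then obtain x y where xy: "S = {x, y}" "x \<noteq> y"
      by (auto simp: card_2_iff)
    then show ?thesis using nb[of x y] by blast
  next
    case 3
    then obtain x y z where xyz: "S = {x, y, z}" "x \<noteq> y" "x \<noteq> z" "y \<noteq> z"
      by (auto simp: card_3_iff)
    have "x \<rightarrow>\<^bsub>G\<^esub> y \<or> x \<rightarrow>\<^bsub>G\<^esub> z" "x \<rightarrow>\<^bsub>G\<^esub> y \<or> y \<rightarrow>\<^bsub>G\<^esub> z" "x \<rightarrow>\<^bsub>G\<^esub> z \<or> y \<rightarrow>\<^bsub>G\<^esub> z"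
      using nb[of x y] nb[of y x] nb[of z x] xyz sym[of x y] sym[of x z] sym[of y z] by blast+
    then consider "x \<rightarrow>\<^bsub>G\<^esub> y" "x \<rightarrow>\<^bsub>G\<^esub> z" | "y \<rightarrow>\<^bsub>G\<^esub> x" "y \<rightarrow>\<^bsub>G\<^esub> z" | "z \<rightarrow>\<^bsub>G\<^esub> x" "z \<rightarrow>\<^bsub>G\<^esub> y"
      using sym[of x y] sym[of x z] sym[of y z] by blast
    then show ?thesis unfolding xyz(1) by cases blast+
  qed
qed

section \<open>Distances in the Petersen graph\<close>

lemma pverts_petersen: "pverts petersen = {A. A \<subseteq> {0..<5} \<and> card A = 2}"
  by (simp add: petersen_def)

lemma finite_pvert_petersen: "A \<in> pverts petersen \<Longrightarrow> finite A"
  by (auto simp: pverts_petersen intro: finite_subset)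

lemma parcs_petersen:
  "(A, B) \<in> parcs petersen \<longleftrightarrow>
     A \<in> pverts petersen \<and> B \<in> pverts petersen \<and> A \<inter> B = {}"
  by (auto simp: petersen_def)

text \<open>
  Two intersecting vertices cover at most three of the five points, so a vertex disjoint from both
  remains.
\<close>

lemma common_neighbour_petersen:
  assumes A: "A \<in> pverts petersen" and B: "B \<in> pverts petersen"
    and meet: "A \<inter> B \<noteq> {}"
  obtains C where "(A, C) \<in> parcs petersen" "(C, B) \<in> parcs petersen"
proof -
  note fin = finite_pvert_petersen[OF A] finite_pvert_petersen[OF B]
  have "card (A \<inter> B) \<noteq> 0" using meet fin by simp
  moreover have "card (A \<union> B) + card (A \<inter> B) = 4"
    using card_Un_Int[OF fin] A B by (simp add: pverts_petersen)
  ultimately have "card (A \<union> B) \<le> 3" by simp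
  then have "card ({0..<5} - (A \<union> B)) \<ge> 2"
    using A B fin by (subst card_Diff_subset) (auto simp: pverts_petersen)
  then obtain C where C: "C \<subseteq> {0..<5} - (A \<union> B)" "card C = 2"
    by (meson obtain_subset_with_card_n)
  then show thesis
    using A B by (intro that[of C]) (auto simp: parcs_petersen pverts_petersen)
qed

lemma gdist_petersen:
  assumes A: "A \<in> pverts petersen" and B: "B \<in> pverts petersen"
  shows "gdist (with_proj petersen) A B = (if A = B then 0 else if A \<inter> B = {} then 1 else 2)"
proof -
  interpret pair_graph petersen by (rule pair_graph_petersen)
  consider "A = B" | "A \<noteq> B" "A \<inter> B = {}" | "A \<noteq> B" "A \<inter> B \<noteq> {}" by blast
  then show ?thesis
  proof cases
    case 1
    then show ?thesis using A by (simp add: gdist_self)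
  next
    case 2
    then show ?thesis using gdist_adjacent[of A B] A B by (simp add: parcs_petersen)
  next
    case 3
    then obtain C where "(A, C) \<in> parcs petersen" "(C, B) \<in> parcs petersen"
      using common_neighbour_petersen A B by blast
    then show ?thesis
      using 3 gdist_common_neighbour[of A C B] by (simp add: parcs_petersen)
  qed
qed

lemma resolving_set_mono:
  "resolving_set G S \<Longrightarrow> S \<subseteq> T \<Longrightarrow> T \<subseteq> verts G \<Longrightarrow> resolving_set G T"
  unfolding resolving_set_def by blast

section \<open>Connected sets of at most three vertices\<close>

text \<open>
  The two neighbours of the end \<open>a\<close> other than \<open>b\<close> have distance one from \<open>a\<close> and two from both
  \<open>b\<close> and \<open>c\<close>, so the path cannot tell them apart.
\<close>

lemma not_resolving_path3:
  assumes a: "a \<in> pverts petersen" and b: "b \<in> pverts petersen"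
    and c: "c \<in> pverts petersen"
    and ab: "a \<inter> b = {}" and bc: "b \<inter> c = {}" and "a \<noteq> c"
  shows "\<not> resolving_set (with_proj petersen) {a, b, c}"
proof -
  note fin = finite_pvert_petersen[OF a] finite_pvert_petersen[OF b] finite_pvert_petersen[OF c]
  obtain r s where rs: "b = {r, s}" "r \<noteq> s"
    using b by (auto simp: pverts_petersen card_2_iff)
  have "card ({0..<5} - (a \<union> b)) = 1"
    using a b ab fin by (subst card_Diff_subset) (auto simp: pverts_petersen card_Un_disjoint)
  then obtain t where t: "{0..<5} - (a \<union> b) = {t}"
    by (auto simp: card_1_singleton_iff)
  \<comment> \<open>The neighbours of \<open>b\<close> are the pairs in \<open>insert t a\<close>; all of them except \<open>a\<close> contain \<open>t\<close>.\<close>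
  have "t \<in> c"
  proof (rule ccontr)
    assume "t \<notin> c"
    then have "c \<subseteq> a" using c bc t by (auto simp: pverts_petersen)
    then show False using card_subset_eq[OF fin(1), of c] a c \<open>a \<noteq> c\<close> by (simp add: pverts_petersen)
  qed
  \<comment> \<open>The points outside \<open>a\<close> are \<open>r\<close>, \<open>s\<close>, \<open>t\<close>, so these two pairs are the
    neighbours of \<open>a\<close> other than \<open>b\<close>.\<close>
  let ?x = "{s, t}" and ?y = "{r, t}"
  have "t \<in> {0..<5} - (a \<union> b)" using t by blast
  then have "t \<noteq> r" "t \<noteq> s" "t \<notin> a" "t < 5" using rs(1) by simp_all
  then have x: "?x \<in> pverts petersen" and y: "?y \<in> pverts petersen"
    using b rs by (auto simp: pverts_petersen)
  have "r \<notin> a" "s \<notin> a" "r \<notin> c" "s \<notin> c" using ab bc rs by auto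
  then have "gdist (with_proj petersen) ?x z = gdist (with_proj petersen) ?y z"
    if "z \<in> {a, b, c}" for z
    using that a b c x y rs \<open>t \<in> c\<close> \<open>t \<notin> a\<close> \<open>t \<noteq> r\<close> \<open>t \<noteq> s\<close>
    by (auto simp: gdist_petersen)
  moreover have "?x \<noteq> ?y" using rs(2) by (simp add: doubleton_eq_iff)
  ultimately show ?thesis
    using x y unfolding resolving_set_def with_proj_simps by (metis (no_types, lifting))
qed

lemma card_neighbours_petersen:
  assumes b: "b \<in> pverts petersen"
  shows "card {x. (b, x) \<in> parcs petersen} = 3"
proof -
  have "{x. (b, x) \<in> parcs petersen} = {x. x \<subseteq> {0..<5} - b \<and> card x = 2}"
    using b by (auto simp: parcs_petersen pverts_petersen)
  moreover have "card ({0..<5} - b) = 3"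
    using b finite_pvert_petersen[OF b] by (subst card_Diff_subset) (auto simp: pverts_petersen)
  ultimately show ?thesis by (simp add: n_subsets choose_two)
qed

lemma connected_resolving_set_petersen_card_ge:
  assumes "connected_resolving_set (with_proj petersen) S"
  shows "4 \<le> card S"
proof (rule ccontr)
  interpret pair_graph petersen by (rule pair_graph_petersen)
  assume "\<not> 4 \<le> card S"
  then have card: "card S \<le> 3" by simp
  have res: "resolving_set (with_proj petersen) S"
    and conn: "Digraph_Component.connected (with_proj petersen \<restriction> S)"
    using assms by (auto simp: connected_resolving_set_def)
  have sub: "S \<subseteq> pverts petersen" using res by (simp add: resolving_set_def)
  then have fin: "finite S" by (rule finite_subset) simp
  obtain b where b: "b \<in> S" and star: "\<And>x. x \<in> S - {b} \<Longrightarrow> (b, x) \<in> parcs petersen"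
    using connected_induce_card_le_3_star[OF conn fin card] by blast
  have bv: "b \<in> pverts petersen" using b sub by blast
  let ?N = "{x. (b, x) \<in> parcs petersen}"
  note card_N = card_neighbours_petersen[OF bv]
  have "finite ?N" using card_N by (simp add: card_ge_0_finite)
  moreover have "S - {b} \<subseteq> ?N" using star by auto
  moreover have "card (S - {b}) \<le> 2" using card b fin by simp
  \<comment> \<open>If \<open>S\<close> has fewer than three vertices, it is enlarged to a path by further neighbours of \<open>b\<close>.\<close>
  ultimately obtain U where U: "S - {b} \<subseteq> U" "U \<subseteq> ?N" "card U = 2"
    using exists_subset_between[of "S - {b}" 2 ?N] card_N by fastforce
  then obtain a c where "U = {a, c}" "a \<noteq> c"
    by (auto simp: card_2_iff)
  with U have ac: "S - {b} \<subseteq> {a, c}" "{a, c} \<subseteq> ?N" "a \<noteq> c" by simp_all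
  have "a \<in> pverts petersen" "c \<in> pverts petersen" "a \<inter> b = {}" "b \<inter> c = {}"
    using ac(2) unfolding parcs_petersen by blast+
  moreover have "resolving_set (with_proj petersen) {a, b, c}"
  proof (rule resolving_set_mono[OF res])
    show "S \<subseteq> {a, b, c}" using ac(1) by blast
    show "{a, b, c} \<subseteq> verts (with_proj petersen)" using calculation bv by simp
  qed
  ultimately show False
    using not_resolving_path3[OF _ bv[unfolded with_proj_simps], of a c] ac(3) by blast
qed

section \<open>Paths of four vertices\<close>

lemma pverts_petersen_subset:
  assumes "{0..<5} = {p, q, r, s, t}"
  shows "pverts petersen \<subseteq>
    {{p, q}, {p, r}, {p, s}, {p, t}, {q, r}, {q, s}, {q, t}, {r, s}, {r, t}, {s, t}}"
proof
  fix A assume "A \<in> pverts petersen"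
  then have A: "A \<subseteq> {p, q, r, s, t}" "card A = 2"
    by (simp_all add: pverts_petersen assms)
  from A(2) obtain x y where xy: "A = {x, y}" "x \<noteq> y"
    unfolding card_2_iff by blast
  then have "x \<in> {p, q, r, s, t}" "y \<in> {p, q, r, s, t}"
    using A(1) by simp_all
  then show "A \<in> {{p, q}, {p, r}, {p, s}, {p, t}, {q, r}, {q, s}, {q, t}, {r, s}, {r, t}, {s, t}}"
    using xy(2) unfolding xy(1) by (elim insertE emptyE) (simp_all add: insert_commute)
qed

text \<open>
  The four vertices are the consecutive vertices of an induced path. The points are labelled
  arbitrarily, so any vertex can play the role of the end \<open>{p, q}\<close>.
\<close>

lemma resolving_path4:
  assumes dist: "distinct [p, q, r, s, t]" and range: "{0..<5} = {p, q, r, s, t}"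
  shows "resolving_set (with_proj petersen) {{p, q}, {r, s}, {p, t}, {q, r}}"
proof -
  have neq:
    "p \<noteq> q" "p \<noteq> r" "p \<noteq> s" "p \<noteq> t" "q \<noteq> p" "q \<noteq> r" "q \<noteq> s" "q \<noteq> t" "r \<noteq> p" "r \<noteq> q"
    "r \<noteq> s" "r \<noteq> t" "s \<noteq> p" "s \<noteq> q" "s \<noteq> r" "s \<noteq> t" "t \<noteq> p" "t \<noteq> q" "t \<noteq> r" "t \<noteq> s"
    using dist by auto
  let ?P = "{{p, q}, {r, s}, {p, t}, {q, r}}"
  have sub: "?P \<subseteq> pverts petersen"
    using dist unfolding pverts_petersen range by auto
  have "x = y"
    if x: "x \<in> pverts petersen" and y: "y \<in> pverts petersen"
      and eq: "\<forall>z \<in> ?P. gdist (with_proj petersen) x z = gdist (with_proj petersen) y z" for x y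
  proof -
    define code :: "nat set \<Rightarrow> ereal list" where
      "code A = map (\<lambda>B. if A = B then 0 else if A \<inter> B = {} then 1 else 2)
         [{p, q}, {r, s}, {p, t}, {q, r}]" for A
    have "code x = code y"
      using eq sub x y unfolding code_def by (simp add: gdist_petersen)
    \<comment> \<open>The rows are the path in order, the common neighbour of its ends, the private neighbours of
      the path vertices in order, and the vertex without neighbours on the path.\<close>
    moreover have
      "code {p, q} = [0, 1, 2, 2]" "code {r, s} = [1, 0, 1, 2]"
      "code {p, t} = [2, 1, 0, 1]" "code {q, r} = [2, 2, 1, 0]"
      "code {s, t} = [1, 2, 2, 1]" "code {r, t} = [1, 2, 2, 2]"
      "code {q, t} = [2, 1, 2, 2]" "code {q, s} = [2, 2, 1, 2]"
      "code {p, s} = [2, 2, 2, 1]" "code {p, r} = [2, 2, 2, 2]"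
      unfolding code_def by (simp_all add: doubleton_eq_iff neq)
    moreover note subsetD[OF pverts_petersen_subset[OF range] x]
      subsetD[OF pverts_petersen_subset[OF range] y]
    ultimately show ?thesis
      by (elim insertE emptyE) simp_all
  qed
  then show ?thesis using sub unfolding resolving_set_def with_proj_simps by blast
qed

lemma connected_resolving_set_petersen_at:
  assumes v: "v \<in> pverts petersen"
  obtains S where "connected_resolving_set (with_proj petersen) S" "v \<in> S" "card S = 4"
proof -
  obtain p q where v_eq: "v = {p, q}" "p \<noteq> q"
    using v by (auto simp: pverts_petersen card_2_iff)
  have "card ({0..<5} - v) = 3"
    using v finite_pvert_petersen[OF v] by (subst card_Diff_subset) (auto simp: pverts_petersen)
  then obtain r s t where rst: "{0..<5} - v = {r, s, t}" "distinct [r, s, t]"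
    by (auto simp: card_3_iff)
  have "v \<subseteq> {0..<5}" using v by (simp add: pverts_petersen)
  then have range: "{0..<5} = {p, q, r, s, t}" using rst(1) v_eq by blast
  have "r \<notin> v" "s \<notin> v" "t \<notin> v" using rst(1) by blast+
  then have dist: "distinct [p, q, r, s, t]" using rst(2) v_eq by auto
  let ?P = "{{p, q}, {r, s}, {p, t}, {q, r}}"
  have vs: "{p, q} \<in> pverts petersen" "{r, s} \<in> pverts petersen"
    "{p, t} \<in> pverts petersen" "{q, r} \<in> pverts petersen"
    using dist unfolding pverts_petersen range by auto
  have arcs: "({p, q}, {r, s}) \<in> parcs petersen" "({r, s}, {p, t}) \<in> parcs petersen"
    "({p, t}, {q, r}) \<in> parcs petersen"
    using dist vs by (auto simp: parcs_petersen)
  have "Digraph_Component.connected (with_proj petersen \<restriction> ?P)"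
    using arcs
    by (intro connected_induce_insert[where b = "{r, s}"] connected_induce_insert[where b = "{p, t}"]
        connected_induce_insert[where b = "{q, r}"] connected_induce_singleton) simp_all
  moreover have "card ?P = 4" using dist by (auto simp: card_insert_if doubleton_eq_iff)
  ultimately show thesis
    using resolving_path4[OF dist range] v_eq
    by (intro that[of ?P]) (simp_all add: connected_resolving_set_def)
qed

theorem proposition5p5:
  shows "cdim (with_proj petersen) = 4 \<and>
    (\<forall>v \<in> verts (with_proj petersen). cdim_at (with_proj petersen) v = 4)"
proof (intro conjI ballI)
  have "{0, 1} \<in> pverts petersen"
    by (auto simp: pverts_petersen)
  then obtain S where "connected_resolving_set (with_proj petersen) S" "card S = 4"
    by (blast elim: connected_resolving_set_petersen_at)
  then show "cdim (with_proj petersen) = 4"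
    unfolding cdim_def
    by (intro Least_equality) (auto dest: connected_resolving_set_petersen_card_ge)
next
  fix v assume "v \<in> verts (with_proj petersen)"
  then have "v \<in> pverts petersen" by simp
  then obtain S where "connected_resolving_set (with_proj petersen) S" "v \<in> S" "card S = 4"
    by (rule connected_resolving_set_petersen_at)
  then show "cdim_at (with_proj petersen) v = 4"
    unfolding cdim_at_def
    by (intro Least_equality) (auto dest: connected_resolving_set_petersen_card_ge)
qed

end
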